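(* Let $n\ge3$ and $m\ge1$ be integers and let $o_1$ be the condition "$\frac{n^2-n+2m+2}{4}\in\mathbb{Z}$", $o_2$ its negation. Then $$Mcut(LP_{n,m})=\begin{cases}\frac{n^2-n+2m}{(2m-1)(n^2-n+1)} & \text{if } 2\le m\le\frac{n^2-n+4}{2},\\[2pt] \frac{4}{n^2-n+2m} & \text{if } o_1 \text{ and } m>\frac{n^2-n+4}{2},\\[2pt] \frac{4(n^2-n+2m)}{(n(n-1)+2(m-1))(n(n-1)+2(m+1))} & \text{if } o_2 \text{ and } m>\frac{n^2-n+4}{2},\\[2pt] \frac{n^2-n+2}{(n+1)(n-1)} & \text{if } m=1.\end{cases}$$
   Context: The lollipop graph $LP_{n,m}$ ($n\ge3,m\ge1$) is the unweighted graph with vertices $x_1,\dots,x_m,y_1,\dots,y_n$ and edges $x_ix_{i+1}$ ($1\le i\le m-1$), $y_iy_j$ for all $i\ne j$ (so $y_1,\dots,y_n$ form a complete graph $K_n$), and $x_my_1$. For a graph $G=(V,E)$ with degrees $d_v$: $vol(S)=\sum_{v\in S}d_v$; $cut(S,T)$ is the number of edges between disjoint $S,T$; $Ncut(S,T)=cut(S,T)(1/vol(S)+1/vol(T))$; $Mcut(G)=\min\{Ncut(S,V\setminus S):\emptyset\ne S\subsetneq V\}$. *)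

theory Defs
  imports Complex_Main
begin

text \<open>Undirected simple graphs: edges are two-element subsets of the vertex set.\<close>

record 'a ugraph =
  verts :: "'a set"
  edges :: "'a set set"

definition degree :: "'a ugraph \<Rightarrow> 'a \<Rightarrow> nat" where
  "degree G v = card {e \<in> edges G. v \<in> e}"

definition vol :: "'a ugraph \<Rightarrow> 'a set \<Rightarrow> nat" where
  "vol G S = (\<Sum>v\<in>S. degree G v)"

definition cut :: "'a ugraph \<Rightarrow> 'a set \<Rightarrow> 'a set \<Rightarrow> nat" where
  "cut G S T = card {e \<in> edges G. \<exists>u\<in>S. \<exists>v\<in>T. e = {u, v}}"

text \<open>
  A set of volume \<open>0\<close> contributes \<open>1 / 0 = 0\<close> here; in a finite graph without isolated
  vertices (such as the lollipop graph) every nonempty set of vertices has positive volume.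
\<close>

definition Ncut :: "'a ugraph \<Rightarrow> 'a set \<Rightarrow> 'a set \<Rightarrow> real" where
  "Ncut G S T = real (cut G S T) * (1 / real (vol G S) + 1 / real (vol G T))"

text \<open>
  Meaningful for finite graphs with at least two vertices, where the argument of
  \<open>Min\<close> is finite and nonempty.
\<close>

definition Mcut :: "'a ugraph \<Rightarrow> real" where
  "Mcut G = Min {Ncut G S (verts G - S) | S. S \<noteq> {} \<and> S \<subset> verts G}"

datatype lp_vertex = X nat | Y nat

definition lollipop :: "nat \<Rightarrow> nat \<Rightarrow> lp_vertex ugraph" where
  "lollipop n m =
    \<lparr> verts = {X i | i. 1 \<le> i \<and> i \<le> m} \<union> {Y j | j. 1 \<le> j \<and> j \<le> n},
      edges = {{X i, X (i + 1)} | i. 1 \<le> i \<and> i + 1 \<le> m}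
            \<union> {{Y i, Y j} | i j. 1 \<le> i \<and> i \<le> n \<and> 1 \<le> j \<and> j \<le> n \<and> i \<noteq> j}
            \<union> {{X m, Y 1}} \<rparr>"

end

theory Submission
  imports Defs
begin

text \<open>
  Write \<open>W = n (n - 1) + 2 m\<close> for the total volume, so that a cut with \<open>c\<close> edges and volumes
  \<open>v\<close>, \<open>W - v\<close> has \<open>Ncut = c W / (v (W - v))\<close>. Connectedness gives \<open>c \<ge> 1\<close>, and the handshake
  identity gives \<open>v \<equiv> c\<close> modulo 2. The candidates \<open>{x\<^sub>1, \<dots>, x\<^sub>k}\<close> have \<open>c = 1\<close> and
  \<open>v = 2 k - 1\<close>. If the path is long, \<open>v\<close> can be chosen to be \<open>W / 2\<close> when this is odd, and
  \<open>W / 2 - 1\<close> otherwise, where parity excludes \<open>v = W / 2\<close> for \<open>c = 1\<close>. If the path is short, the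
  whole path is optimal: sides inside the path have \<open>v \<le> 2 m - 1\<close>, and a side with \<open>a\<close> vertices of
  the clique, \<open>0 < a < n\<close>, has \<open>c \<ge> a (n - a)\<close>, which is too expensive. For \<open>m = 1\<close> it is
  cheaper to cut off \<open>{x\<^sub>1, y\<^sub>1}\<close>.
\<close>

section \<open>Degrees, volumes and cuts in arbitrary graphs\<close>

text \<open>Sending a neighbour \<open>u\<close> to \<open>{v, u}\<close> is a bijection onto the
  edges at \<open>v\<close>. Neighbour sets are easier to compute in the lollipop: a case split on
  the constructor of \<open>u\<close> reduces them to the simp rules for edges.\<close>

lemma degree_eq_card_neighbours:
  assumes "\<And>e. e \<in> edges G \<Longrightarrow> card e = 2"
  shows "degree G v = card {u. {v, u} \<in> edges G}"
proof -
  have "{e \<in> edges G. v \<in> e} = (\<lambda>u. {v, u}) ` {u. {v, u} \<in> edges G}"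
  proof (intro equalityI subsetI)
    fix e assume "e \<in> {e \<in> edges G. v \<in> e}"
    then have e: "e \<in> edges G" "v \<in> e" "card e = 2"
      using assms by auto
    then obtain x y where "e = {x, y}"
      by (meson card_2_iff)
    with e have "e = {v, x} \<or> e = {v, y}"
      by auto
    with e show "e \<in> (\<lambda>u. {v, u}) ` {u. {v, u} \<in> edges G}"
      by auto
  qed auto
  moreover have "inj_on (\<lambda>u. {v, u}) {u. {v, u} \<in> edges G}"
    by (auto simp: inj_on_def doubleton_eq_iff)
  ultimately show ?thesis
    by (simp add: degree_def card_image)
qed

text \<open>Double counting of the incidences between \<open>S\<close> and the edges: an edge has
  two, one or no endpoints in \<open>S\<close>, and exactly one if and only if it crosses to the
  complement. Later only the parity matters.\<close>

lemma vol_eq_twice_inner_plus_cut: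
  assumes fin: "finite (edges G)" "finite S"
    and edges: "\<And>e. e \<in> edges G \<Longrightarrow> card e = 2 \<and> e \<subseteq> verts G"
  shows "vol G S = 2 * card {e \<in> edges G. e \<subseteq> S} + cut G S (verts G - S)"
proof -
  have "vol G S = (\<Sum>v\<in>S. \<Sum>e\<in>edges G. if v \<in> e then 1 else 0)"
    unfolding vol_def degree_def card_eq_sum sum.inter_filter[OF fin(1)] ..
  also have "\<dots> = (\<Sum>e\<in>edges G. \<Sum>v\<in>S. if v \<in> e then 1 else 0)"
    by (rule sum.swap)
  also have "\<dots> = (\<Sum>e\<in>edges G. (if e \<subseteq> S then 2 else 0)
      + (if \<exists>u\<in>S. \<exists>v\<in>verts G - S. e = {u, v} then 1 else 0))"
  proof (rule sum.cong[OF refl])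
    fix e assume e: "e \<in> edges G"
    obtain x y where xy: "e = {x, y}" "x \<noteq> y"
      using edges[OF e] unfolding card_2_iff by blast
    have V: "x \<in> verts G" "y \<in> verts G"
      using edges[OF e] xy by auto
    have "(\<Sum>v\<in>S. if v \<in> e then 1 else 0) = card (S \<inter> e)"
      unfolding card_eq_sum by (rule sum.inter_restrict[OF fin(2), symmetric])
    also have "\<dots> = (if x \<in> S then 1 else 0) + (if y \<in> S then 1 else 0)"
      unfolding xy(1) using xy(2) by (cases "x \<in> S"; cases "y \<in> S") simp_all
    also have "\<dots> = (if e \<subseteq> S then 2 else 0)
      + (if \<exists>u\<in>S. \<exists>v\<in>verts G - S. e = {u, v} then 1 else 0)"
      using xy V by (cases "x \<in> S"; cases "y \<in> S") (auto simp: doubleton_eq_iff)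
    finally show "(\<Sum>v\<in>S. if v \<in> e then 1 else 0) = (if e \<subseteq> S then 2 else 0)
      + (if \<exists>u\<in>S. \<exists>v\<in>verts G - S. e = {u, v} then 1 else (0::nat))" .
  qed
  also have "\<dots> = 2 * card {e \<in> edges G. e \<subseteq> S} + cut G S (verts G - S)"
    unfolding sum.distrib cut_def card_eq_sum sum.inter_filter[OF fin(1)] sum_distrib_left
    by (rule arg_cong2[where f = "(+)"]; rule sum.cong[OF refl]; simp)
  finally show ?thesis .
qed

lemma cut_commute: "cut G S T = cut G T S"
  by (auto simp: cut_def intro!: arg_cong[where f = card] simp: insert_commute)

section \<open>Vertices and edges of the lollipop graph\<close>

lemma verts_lollipop: "verts (lollipop n m) = X ` {1..m} \<union> Y ` {1..n}"
  by (auto simp: lollipop_def)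

lemma finite_verts_lollipop [simp]: "finite (verts (lollipop n m))"
  by (simp add: verts_lollipop)

lemma X_in_verts [simp]: "X i \<in> verts (lollipop n m) \<longleftrightarrow> 1 \<le> i \<and> i \<le> m"
  by (auto simp: verts_lollipop)

lemma Y_in_verts [simp]: "Y j \<in> verts (lollipop n m) \<longleftrightarrow> 1 \<le> j \<and> j \<le> n"
  by (auto simp: verts_lollipop)

lemma XX_edge [simp]:
  "{X i, X j} \<in> edges (lollipop n m) \<longleftrightarrow>
    1 \<le> i \<and> i \<le> m \<and> 1 \<le> j \<and> j \<le> m \<and> (j = i + 1 \<or> i = j + 1)"
  by (auto simp: lollipop_def doubleton_eq_iff)

lemma XY_edge [simp]: "{X i, Y j} \<in> edges (lollipop n m) \<longleftrightarrow> i = m \<and> j = 1"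
  by (auto simp: lollipop_def doubleton_eq_iff)

lemma YX_edge [simp]: "{Y j, X i} \<in> edges (lollipop n m) \<longleftrightarrow> i = m \<and> j = 1"
  by (auto simp: lollipop_def doubleton_eq_iff)

lemma YY_edge [simp]:
  "{Y i, Y j} \<in> edges (lollipop n m) \<longleftrightarrow> 1 \<le> i \<and> i \<le> n \<and> 1 \<le> j \<and> j \<le> n \<and> i \<noteq> j"
  by (auto simp: lollipop_def doubleton_eq_iff)

lemma finite_X_Y_preimages:
  assumes "S \<subseteq> verts (lollipop n m)"
  shows "finite {i. X i \<in> S}" "finite {j. Y j \<in> S}"
proof -
  have "{i. X i \<in> S} \<subseteq> {1..m}" "{j. Y j \<in> S} \<subseteq> {1..n}"
    using assms by auto
  then show "finite {i. X i \<in> S}" "finite {j. Y j \<in> S}"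
    by (auto intro: finite_subset)
qed

lemma card_Y_complement:
  assumes "S \<subseteq> verts (lollipop n m)"
  shows "card {j. Y j \<in> S} \<le> n"
    and "card {j. Y j \<in> verts (lollipop n m) - S} = n - card {j. Y j \<in> S}"
proof -
  have sub: "{j. Y j \<in> S} \<subseteq> {1..n}"
    using assms by auto
  have "{j. Y j \<in> verts (lollipop n m) - S} = {1..n} - {j. Y j \<in> S}"
    by auto
  then show "card {j. Y j \<in> verts (lollipop n m) - S} = n - card {j. Y j \<in> S}"
    using sub by (simp add: card_Diff_subset finite_subset)
  show "card {j. Y j \<in> S} \<le> n"
    using card_mono[OF _ sub] by simp
qed

lemma path_degree_sum: "k \<ge> 1 \<Longrightarrow> (\<Sum>i=1..k. if i = 1 then 1 else 2 :: nat) = 2 * k - 1"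
  by (induction k rule: dec_induct) auto

section \<open>Degrees and volumes in the lollipop graph\<close>

context
  fixes n m :: nat
  assumes n3: "n \<ge> 3" and m1: "m \<ge> 1"
begin

lemma edge_lollipop:
  assumes "e \<in> edges (lollipop n m)"
  shows "card e = 2 \<and> e \<subseteq> verts (lollipop n m)"
  using assms n3 m1 by (auto simp: lollipop_def)

lemma finite_edges_lollipop: "finite (edges (lollipop n m))"
proof (rule finite_subset)
  show "edges (lollipop n m) \<subseteq> Pow (verts (lollipop n m))"
    using edge_lollipop by blast
qed simp

text \<open>At the end of the path, \<open>Y 1\<close> takes the place of the missing successor, so
  only \<open>X 1\<close> has degree 1, also for \<open>m = 1\<close>.\<close>

lemma degree_X:
  assumes "1 \<le> i" "i \<le> m"
  shows "degree (lollipop n m) (X i) = (if i = 1 then 1 else 2)"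
proof -
  have "{u. {X i, u} \<in> edges (lollipop n m)} =
      (if i = 1 then {} else {X (i - 1)}) \<union> {if i = m then Y 1 else X (i + 1)}" (is "?L = ?R")
  proof (rule set_eqI)
    fix u show "u \<in> ?L \<longleftrightarrow> u \<in> ?R"
      using assms by (cases u) auto
  qed
  then show ?thesis
    using edge_lollipop by (auto simp: degree_eq_card_neighbours card_insert_if)
qed

lemma degree_Y:
  assumes "1 \<le> j" "j \<le> n"
  shows "degree (lollipop n m) (Y j) = n - 1 + (if j = 1 then 1 else 0)"
proof -
  have "{u. {Y j, u} \<in> edges (lollipop n m)} =
      Y ` ({1..n} - {j}) \<union> (if j = 1 then {X m} else {})" (is "?L = ?R")
  proof (rule set_eqI)
    fix u show "u \<in> ?L \<longleftrightarrow> u \<in> ?R"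
      using assms by (cases u) auto
  qed
  moreover have "card (Y ` ({1..n} - {j})) = n - 1"
    using assms by (subst card_image) (auto simp: inj_on_def)
  moreover have "card (Y ` ({1..n} - {j}) \<union> {X m}) = n - 1 + 1"
    using calculation(2) by (subst card_Un_disjoint) auto
  ultimately show ?thesis
    using edge_lollipop by (auto simp: degree_eq_card_neighbours)
qed

text \<open>The last summand is the extra degree that \<open>Y 1\<close> owes to the bridge
  \<open>{X m, Y 1}\<close>. The path part remains a sum, to be bounded or evaluated as each
  application requires.\<close>

lemma vol_split:
  assumes "S \<subseteq> verts (lollipop n m)"
  shows "vol (lollipop n m) S = card {j. Y j \<in> S} * (n - 1)
    + (\<Sum>i | X i \<in> S. if i = 1 then 1 else 2) + (if Y 1 \<in> S then 1 else 0)"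
proof -
  note fin = finite_X_Y_preimages[OF assms]
  have "S = X ` {i. X i \<in> S} \<union> Y ` {j. Y j \<in> S}"
  proof (rule set_eqI)
    fix u show "u \<in> S \<longleftrightarrow> u \<in> X ` {i. X i \<in> S} \<union> Y ` {j. Y j \<in> S}"
      by (cases u) auto
  qed
  then have "vol (lollipop n m) S =
      (\<Sum>v\<in>X ` {i. X i \<in> S} \<union> Y ` {j. Y j \<in> S}. degree (lollipop n m) v)"
    by (simp add: vol_def)
  also have "\<dots> = (\<Sum>i | X i \<in> S. degree (lollipop n m) (X i))
      + (\<Sum>j | Y j \<in> S. degree (lollipop n m) (Y j))"
    using fin by (subst sum.union_disjoint) (auto simp: sum.reindex inj_on_def)
  also have "(\<Sum>i | X i \<in> S. degree (lollipop n m) (X i)) = (\<Sum>i | X i \<in> S. if i = 1 then 1 else 2)"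
    using assms by (intro sum.cong refl degree_X) auto
  also have "(\<Sum>j | Y j \<in> S. degree (lollipop n m) (Y j)) =
      (\<Sum>j | Y j \<in> S. n - 1 + (if j = 1 then 1 else 0))"
    using assms by (intro sum.cong refl degree_Y) auto
  also have "\<dots> = card {j. Y j \<in> S} * (n - 1) + (if Y 1 \<in> S then 1 else 0)"
    using fin by (simp add: sum.distrib sum.delta)
  finally show ?thesis
    by simp
qed

lemma path_degree_sum_le:
  assumes "S \<subseteq> verts (lollipop n m)"
  shows "(\<Sum>i | X i \<in> S. if i = 1 then 1 else 2 :: nat) \<le> 2 * m - 1"
proof -
  have "(\<Sum>i | X i \<in> S. if i = 1 then 1 else 2 :: nat) \<le> (\<Sum>i=1..m. if i = 1 then 1 else 2)"
    using assms by (intro sum_mono2) auto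
  then show ?thesis
    using path_degree_sum m1 by simp
qed

lemma vol_verts: "vol (lollipop n m) (verts (lollipop n m)) = n * (n - 1) + 2 * m"
proof -
  have "{i. X i \<in> verts (lollipop n m)} = {1..m}" "{j. Y j \<in> verts (lollipop n m)} = {1..n}"
    by auto
  then show ?thesis
    using vol_split[OF subset_refl] path_degree_sum[OF m1] n3 m1 by simp
qed

lemma vol_add_complement:
  assumes "S \<subseteq> verts (lollipop n m)"
  shows "vol (lollipop n m) S + vol (lollipop n m) (verts (lollipop n m) - S) = n * (n - 1) + 2 * m"
  using sum.subset_diff[OF assms finite_verts_lollipop, of "degree (lollipop n m)"]
  unfolding vol_verts[symmetric] vol_def by linarith

text \<open>This keeps the convention \<open>1 / 0 = 0\<close> out of \<open>Ncut\<close> for every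
  admissible side.\<close>

lemma vol_pos:
  assumes "S \<subseteq> verts (lollipop n m)" "S \<noteq> {}"
  shows "vol (lollipop n m) S > 0"
  unfolding vol_def
proof (rule sum_pos)
  show "finite S"
    using finite_subset[OF assms(1)] by simp
  fix v assume "v \<in> S"
  with assms(1) show "degree (lollipop n m) v > 0"
    using degree_X degree_Y n3 by (cases v) (auto split: if_splits)
qed (use assms in auto)

section \<open>Parity, connectedness and lower bounds for cuts\<close>

lemma even_vol_iff_even_cut:
  assumes "S \<subseteq> verts (lollipop n m)"
  shows "even (vol (lollipop n m) S) \<longleftrightarrow> even (cut (lollipop n m) S (verts (lollipop n m) - S))"
  using vol_eq_twice_inner_plus_cut[OF finite_edges_lollipop _ edge_lollipop, of S] assms
    finite_subset[OF assms] by simp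

lemma finite_cut_edges: "finite {e \<in> edges (lollipop n m). P e}"
  using finite_edges_lollipop by simp

text \<open>Connectedness: without crossing edges, adjacent vertices lie on the same side. Clique
  vertices are compared with \<open>Y 1\<close> directly, path vertices by induction from
  \<open>X m\<close> downwards, so a single side would contain everything.\<close>

lemma cut_pos:
  assumes S: "S \<subset> verts (lollipop n m)" "S \<noteq> {}"
  shows "cut (lollipop n m) S (verts (lollipop n m) - S) > 0"
proof (rule ccontr)
  let ?V = "verts (lollipop n m)"
  assume "\<not> ?thesis"
  then have none: "{e \<in> edges (lollipop n m). \<exists>u\<in>S. \<exists>v\<in>?V - S. e = {u, v}} = {}"
    using finite_cut_edges by (simp add: cut_def)
  have same: "u \<in> S \<longleftrightarrow> v \<in> S" if "{u, v} \<in> edges (lollipop n m)" for u v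
  proof -
    have "u \<in> ?V" "v \<in> ?V"
      using edge_lollipop[OF that] by auto
    then show ?thesis
      using none that by (auto simp: insert_commute)
  qed
  have clique: "Y j \<in> S \<longleftrightarrow> Y 1 \<in> S" if "1 \<le> j" "j \<le> n" for j
    using same[of "Y j" "Y 1"] that by (cases "j = 1") auto
  have path: "X i \<in> S \<longleftrightarrow> Y 1 \<in> S" if "i \<le> m" "1 \<le> i" for i
    using that
  proof (induction i rule: inc_induct)
    case base
    then show ?case using same[of "X m" "Y 1"] by simp
  next
    case (step i)
    then show ?case using same[of "X i" "X (Suc i)"] by simp
  qed
  have all: "v \<in> S \<longleftrightarrow> Y 1 \<in> S" if "v \<in> ?V" for v
  proof (cases v)
    case (X i)
    with that show ?thesis using path[of i] by simp
  next
    case (Y j)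
    with that show ?thesis using clique[of j] by simp
  qed
  obtain u v where "u \<in> S" "u \<in> ?V" "v \<in> ?V" "v \<notin> S"
    using S by blast
  with all[of u] all[of v] show False
    by simp
qed

text \<open>Every pair of clique vertices on different sides gives a crossing edge, and the bridge
  is a further one if it is split. The summand for the bridge is what makes the bound strong enough
  for \<open>m = 1\<close>.\<close>

lemma cut_ge_clique_cut:
  assumes S: "S \<subseteq> verts (lollipop n m)"
  defines "a \<equiv> card {j. Y j \<in> S}"
  shows "cut (lollipop n m) S (verts (lollipop n m) - S)
    \<ge> a * (n - a) + (if X m \<in> S \<longleftrightarrow> Y 1 \<in> S then 0 else 1)"
proof -
  let ?V = "verts (lollipop n m)"
  let ?A = "{j. Y j \<in> S}" and ?B = "{j. Y j \<in> ?V - S}"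
  let ?K = "(\<lambda>(i, j). {Y i, Y j}) ` (?A \<times> ?B)"
  let ?L = "if X m \<in> S \<longleftrightarrow> Y 1 \<in> S then {} else {{X m, Y 1}}"
  have fin: "finite ?A" "finite ?B"
    using finite_X_Y_preimages S by auto
  have "inj_on (\<lambda>(i, j). {Y i, Y j}) (?A \<times> ?B)"
    by (auto simp: inj_on_def doubleton_eq_iff)
  then have "card ?K = a * (n - a)"
    using card_Y_complement(2)[OF S] by (simp add: card_image card_cartesian_product a_def)
  moreover have "card (?K \<union> ?L) = card ?K + card ?L"
    using fin by (intro card_Un_disjoint) (auto simp: doubleton_eq_iff)
  moreover have "?K \<union> ?L \<subseteq> {e \<in> edges (lollipop n m). \<exists>u\<in>S. \<exists>v\<in>?V - S. e = {u, v}}"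
  proof -
    have "?K \<subseteq> {e \<in> edges (lollipop n m). \<exists>u\<in>S. \<exists>v\<in>?V - S. e = {u, v}}"
    proof clarify
      fix i j assume "Y i \<in> S" "Y j \<in> ?V" "Y j \<notin> S"
      moreover have "{Y i, Y j} \<in> edges (lollipop n m)"
        using calculation S by (auto simp: subset_iff)
      ultimately show "{Y i, Y j} \<in> edges (lollipop n m) \<and> (\<exists>u\<in>S. \<exists>v\<in>?V - S. {Y i, Y j} = {u, v})"
        by blast
    qed
    moreover have "?L \<subseteq> {e \<in> edges (lollipop n m). \<exists>u\<in>S. \<exists>v\<in>?V - S. e = {u, v}}"
    proof -
      have V: "X m \<in> ?V" "Y 1 \<in> ?V" and e: "{X m, Y 1} \<in> edges (lollipop n m)"
        using n3 m1 by auto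
      have "X m \<in> S \<and> Y 1 \<in> ?V - S \<or> Y 1 \<in> S \<and> X m \<in> ?V - S"
        if "(X m \<in> S) \<noteq> (Y 1 \<in> S)"
        using that V by blast
      then have ex: "\<exists>u\<in>S. \<exists>v\<in>?V - S. {X m, Y 1} = {u, v}" if "(X m \<in> S) \<noteq> (Y 1 \<in> S)"
        using that insert_commute[of "X m" "Y 1" "{}"] by blast
      show ?thesis
      proof (cases "(X m \<in> S) = (Y 1 \<in> S)")
        case True
        then show ?thesis by simp
      next
        case False
        then show ?thesis
          using ex[OF False] e by (simp only: if_False) blast
      qed
    qed
    ultimately show ?thesis
      by (rule Un_least)
  qed
  then have "card (?K \<union> ?L) \<le> cut (lollipop n m) S (?V - S)"
    unfolding cut_def by (rule card_mono[OF finite_cut_edges])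
  moreover have "card ?L = (if X m \<in> S \<longleftrightarrow> Y 1 \<in> S then 0 else 1)"
    by simp
  ultimately show ?thesis
    by linarith
qed

section \<open>The candidate sides: initial segments of the path\<close>

lemma prefix_proper:
  assumes "1 \<le> k" "k \<le> m"
  shows "X ` {1..k} \<subset> verts (lollipop n m)" "X ` {1..k} \<noteq> {}"
proof -
  have "Y 1 \<in> verts (lollipop n m) - X ` {1..k}"
    using n3 by auto
  moreover have "X ` {1..k} \<subseteq> verts (lollipop n m)"
    using assms by auto
  ultimately show "X ` {1..k} \<subset> verts (lollipop n m)"
    by blast
  show "X ` {1..k} \<noteq> {}"
    using assms by simp
qed

text \<open>Only the edge from \<open>X k\<close> to its successor can leave, the successor of
  \<open>X m\<close> being \<open>Y 1\<close>. Connectedness shows that the cut is not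
  empty.\<close>

lemma cut_prefix:
  assumes k: "1 \<le> k" "k \<le> m"
  shows "cut (lollipop n m) (X ` {1..k}) (verts (lollipop n m) - X ` {1..k}) = 1"
proof -
  let ?V = "verts (lollipop n m)" and ?S = "X ` {1..k}"
  have "{e \<in> edges (lollipop n m). \<exists>u\<in>?S. \<exists>v\<in>?V - ?S. e = {u, v}}
      \<subseteq> {{X k, if k = m then Y 1 else X (k + 1)}}"
  proof clarify
    fix i v
    assume e: "{X i, v} \<in> edges (lollipop n m)" and i: "i \<in> {1..k}" and v: "v \<notin> ?S"
    show "{X i, v} = {X k, if k = m then Y 1 else X (k + 1)}"
      using e i v k by (cases v) (auto simp: image_iff)
  qed
  then have "cut (lollipop n m) ?S (?V - ?S) \<le> card {{X k, if k = m then Y 1 else X (k + 1)}}"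
    unfolding cut_def by (intro card_mono) auto
  then show ?thesis
    using cut_pos[OF prefix_proper[OF k]] by simp
qed

lemma vol_prefix:
  assumes k: "1 \<le> k" "k \<le> m"
  shows "vol (lollipop n m) (X ` {1..k}) = 2 * k - 1"
proof -
  have "{i. X i \<in> X ` {1..k}} = {1..k}" "{j. Y j \<in> X ` {1..k}} = {}"
    by auto
  moreover have "Y 1 \<notin> X ` {1..k}"
    by auto
  ultimately show ?thesis
    using vol_split[OF psubset_imp_subset[OF prefix_proper(1)[OF k]]] path_degree_sum[OF k(1)]
    by simp
qed

section \<open>Reduction of \<open>Mcut\<close> to inequalities between products of volumes\<close>

lemma Ncut_eq:
  assumes S: "S \<subset> verts (lollipop n m)" "S \<noteq> {}"
  shows "Ncut (lollipop n m) S (verts (lollipop n m) - S) =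
    real (cut (lollipop n m) S (verts (lollipop n m) - S)) * real (n * (n - 1) + 2 * m) /
      (real (vol (lollipop n m) S) * real (vol (lollipop n m) (verts (lollipop n m) - S)))"
proof -
  have "vol (lollipop n m) S > 0" "vol (lollipop n m) (verts (lollipop n m) - S) > 0"
    using vol_pos[of S] vol_pos[of "verts (lollipop n m) - S"] S by auto
  moreover have "real (n * (n - 1) + 2 * m) =
      real (vol (lollipop n m) S) + real (vol (lollipop n m) (verts (lollipop n m) - S))"
    using vol_add_complement[of S] S by (metis of_nat_add psubset_imp_subset)
  ultimately show ?thesis
    by (simp add: Ncut_def field_simps)
qed

text \<open>The total volume is fixed, so minimising \<open>Ncut\<close> means maximising the
  product of the volumes divided by the cut. \<open>D\<close> is this maximum, attained at
  \<open>T\<close>; the bound is stated without division so that it can be proved by integer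
  arithmetic.\<close>

lemma Mcut_eqI:
  fixes D :: real
  assumes D: "D > 0"
    and lower: "\<And>S. S \<subset> verts (lollipop n m) \<Longrightarrow> S \<noteq> {} \<Longrightarrow>
      real (vol (lollipop n m) S) * real (vol (lollipop n m) (verts (lollipop n m) - S))
      \<le> real (cut (lollipop n m) S (verts (lollipop n m) - S)) * D"
    and T: "T \<subset> verts (lollipop n m)" "T \<noteq> {}"
    and eq: "real (vol (lollipop n m) T) * real (vol (lollipop n m) (verts (lollipop n m) - T))
      = real (cut (lollipop n m) T (verts (lollipop n m) - T)) * D"
  shows "Mcut (lollipop n m) = (real (n * (n - 1)) + 2 * real m) / D"
proof -
  let ?V = "verts (lollipop n m)"
  let ?W = "real (n * (n - 1) + 2 * m)"
  have ge: "?W / D \<le> Ncut (lollipop n m) S (?V - S)" if S: "S \<subset> ?V" "S \<noteq> {}" for S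
  proof -
    have "vol (lollipop n m) S > 0" "vol (lollipop n m) (?V - S) > 0"
      using vol_pos[of S] vol_pos[of "?V - S"] S by auto
    then have vw: "real (vol (lollipop n m) S) * real (vol (lollipop n m) (?V - S)) > 0"
      by simp
    have "?W * (real (vol (lollipop n m) S) * real (vol (lollipop n m) (?V - S)))
        \<le> ?W * (real (cut (lollipop n m) S (?V - S)) * D)"
      by (intro mult_left_mono lower S) simp
    then show ?thesis
      unfolding Ncut_eq[OF S] pos_le_divide_eq[OF vw] times_divide_eq_left pos_divide_le_eq[OF D]
      by (simp only: mult_ac)
  qed
  have cut: "cut (lollipop n m) T (?V - T) > 0"
    using cut_pos T by simp
  have "Ncut (lollipop n m) T (?V - T) = ?W / D"
    unfolding Ncut_eq[OF T] eq using cut by simp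
  moreover have "finite {Ncut (lollipop n m) S (?V - S) | S. S \<noteq> {} \<and> S \<subset> ?V}"
    by (rule finite_subset[where B = "(\<lambda>S. Ncut (lollipop n m) S (?V - S)) ` Pow ?V"]) auto
  ultimately have "Mcut (lollipop n m) = ?W / D"
    unfolding Mcut_def using ge T by (intro Min_eqI) (blast, blast, metis (mono_tags, lifting) mem_Collect_eq)
  then show ?thesis
    by simp
qed

text \<open>For \<open>{x_1, ..., x_k}\<close> the cut is 1, hence \<open>D\<close> is simply the
  product of its two volumes and only the bound for all other sides remains to be shown.\<close>

lemma Mcut_eq_prefixI:
  fixes D :: real
  assumes k: "1 \<le> k" "k \<le> m"
    and D: "D = real (2 * k - 1) * real (n * (n - 1) + 2 * m - (2 * k - 1))"
    and lower: "\<And>S. S \<subset> verts (lollipop n m) \<Longrightarrow> S \<noteq> {} \<Longrightarrow>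
      real (vol (lollipop n m) S) * real (vol (lollipop n m) (verts (lollipop n m) - S))
      \<le> real (cut (lollipop n m) S (verts (lollipop n m) - S)) * D"
  shows "Mcut (lollipop n m) = (real (n * (n - 1)) + 2 * real m) / D"
proof (rule Mcut_eqI[OF _ lower])
  let ?T = "X ` {1..k}"
  show T: "?T \<subset> verts (lollipop n m)" "?T \<noteq> {}"
    by (rule prefix_proper[OF k])+
  have "vol (lollipop n m) (verts (lollipop n m) - ?T) = n * (n - 1) + 2 * m - (2 * k - 1)"
    using vol_add_complement[OF psubset_imp_subset[OF T(1)]] vol_prefix[OF k] by linarith
  then show "real (vol (lollipop n m) ?T) * real (vol (lollipop n m) (verts (lollipop n m) - ?T))
      = real (cut (lollipop n m) ?T (verts (lollipop n m) - ?T)) * D"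
    using vol_prefix[OF k] cut_prefix[OF k] D by simp
  have "n * (n - 1) > 0"
    using n3 by simp
  then show "D > 0"
    using k unfolding D by (intro mult_pos_pos; unfold of_nat_0_less_iff; linarith)
qed

text \<open>Collects what the arithmetic needs about a side, over the integers to avoid truncated
  subtraction.\<close>

lemma volumes_cut_facts:
  assumes S: "S \<subset> verts (lollipop n m)" "S \<noteq> {}"
  defines "v \<equiv> int (vol (lollipop n m) S)"
    and "w \<equiv> int (vol (lollipop n m) (verts (lollipop n m) - S))"
    and "c \<equiv> int (cut (lollipop n m) S (verts (lollipop n m) - S))"
  shows "v + w = int n * (int n - 1) + 2 * int m" "c \<ge> 1" "even v \<longleftrightarrow> even c" "v > 0" "w > 0"
proof -
  have "int (n * (n - 1)) = int n * (int n - 1)"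
    using n3 by (simp add: of_nat_diff)
  then show "v + w = int n * (int n - 1) + 2 * int m"
    using vol_add_complement[of S] S unfolding v_def w_def
    by (metis of_nat_add of_nat_mult of_nat_numeral psubset_imp_subset)
  show "c \<ge> 1"
    using cut_pos[OF S] by (simp add: c_def)
  show "even v \<longleftrightarrow> even c"
    using even_vol_iff_even_cut[of S] S by (simp add: v_def c_def psubset_imp_subset)
  show "v > 0" "w > 0"
    using vol_pos[of S] vol_pos[of "verts (lollipop n m) - S"] S by (auto simp: v_def w_def)
qed

end

section \<open>Integer inequalities behind the lower bounds\<close>

lemma of_int_mult_le_of_real:
  assumes "int a * int b \<le> int c * d"
  shows "real a * real b \<le> real c * real_of_int d"
proof -
  have "real_of_int (int a * int b) \<le> real_of_int (int c * d)"
    using assms by (simp only: of_int_le_iff)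
  then show ?thesis
    by simp
qed

lemma even_mult_pred: "even (n * (n - 1 :: nat))"
  by (cases n) auto

text \<open>\<open>N\<close> stands for \<open>n * (n - 1)\<close>, and \<open>c\<close> is
  multiplied by the product for the whole path. As \<open>v + w\<close> is fixed,
  \<open>v * w\<close> exceeds that product only for \<open>v\<close> strictly between
  \<open>N + 1\<close> and \<open>2 * m - 1\<close>; the bound on \<open>m\<close> leaves at most
  the integer \<open>N + 2\<close> there.\<close>

lemma path_side_bound:
  fixes v w c N m :: int
  assumes "v + w = N + 2 * m" "v \<le> 2 * m - 1" "2 * m \<le> N + 4" "c \<ge> 1" "even v \<longleftrightarrow> even c"
    "v > 0" "w > 0" "even N" "N > 0" "m \<ge> 2"
  shows "v * w \<le> c * ((2 * m - 1) * (N + 1))"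
proof -
  let ?D = "(2 * m - 1) * (N + 1)"
  have w: "w = N + 2 * m - v"
    using assms(1) by simp
  \<comment> \<open>the right-hand side is negative only for \<open>v = N + 2 = 2 * m - 2\<close>, where parity forces \<open>c \<ge> 2\<close>\<close>
  have gap: "?D - v * w = (2 * m - 1 - v) * (N + 1 - v)"
    unfolding w by (simp add: algebra_simps)
  have D: "?D \<ge> 1"
    using mult_mono[of 1 "2 * m - 1" 1 "N + 1"] assms by simp
  show ?thesis
  proof (cases "v \<le> N + 1 \<or> v = 2 * m - 1")
    case True
    then have "0 \<le> (2 * m - 1 - v) * (N + 1 - v)"
      using assms by (auto intro: mult_nonneg_nonneg)
    with gap have "v * w \<le> 1 * ?D"
      by simp
    also have "\<dots> \<le> c * ?D"
      using assms D by (intro mult_right_mono) auto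
    finally show ?thesis .
  next
    case False
    then have v: "v = N + 2" "2 * m - 1 = N + 3"
      using assms by auto
    then have "v * w = ?D + 1"
      using gap by simp
    moreover have "even c"
      using v assms by auto
    then have "c \<ge> 2"
      using assms(4) by presburger
    then have "2 * ?D \<le> c * ?D"
      using D by (intro mult_right_mono) auto
    ultimately show ?thesis
      using D by linarith
  qed
qed

text \<open>Here \<open>q\<close> is \<open>n - 1\<close>, the sides have \<open>a\<close> and
  \<open>b\<close> clique vertices, and \<open>s\<close>, \<open>t\<close> are the volumes beyond
  \<open>q\<close> per clique vertex. The leading term \<open>a * b * q\<^sup>2\<close> of the
  product is absorbed by \<open>c \<ge> a * b\<close>; the rest is small because
  \<open>a * b \<ge> q\<close>.\<close>

lemma clique_split_bound:
  fixes a b s t m c q :: int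
  assumes "a \<ge> 1" "b \<ge> 1" "a + b = q + 1" "q \<ge> 2" "s \<ge> 0" "t \<ge> 0" "s + t = 2 * m" "m \<ge> 2"
    "2 * m \<le> q * (q + 1) + 4" "c \<ge> a * b"
  shows "(a * q + s) * (b * q + t) \<le> c * ((2 * m - 1) * (q * (q + 1) + 1))"
proof -
  \<comment> \<open>\<open>?E\<close> is \<open>(2 * m - 1) * (q * (q + 1) + 1)\<close> minus
    \<open>q\<^sup>2\<close>, that is, what remains per clique edge once the leading term is paid
    for.\<close>
  let ?E = "(2 * m - 2) * q\<^sup>2 + (2 * m - 1) * (q + 1)"
  have ab: "a * b \<ge> q"
  proof -
    have "0 \<le> (a - 1) * (b - 1)"
      using assms by simp
    then show ?thesis
      using assms(3) by (simp add: algebra_simps)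
  qed
  have q2: "q\<^sup>2 \<ge> 2 * q"
    using assms by (simp add: power2_eq_square)
  have "s * t \<le> m\<^sup>2"
  proof -
    have t: "t = 2 * m - s"
      using assms(7) by simp
    have "m\<^sup>2 - s * t = (m - s)\<^sup>2"
      unfolding t by (simp add: algebra_simps power2_eq_square)
    then show ?thesis
      using zero_le_power2[of "m - s"] by linarith
  qed
  moreover have "a * t + b * s \<le> q * (2 * m)"
  proof -
    have "a * t \<le> q * t" "b * s \<le> q * s"
      using assms by (auto intro!: mult_right_mono)
    then show ?thesis
      unfolding assms(7)[symmetric] by (simp add: algebra_simps)
  qed
  then have "q * (a * t + b * s) \<le> q * (q * (2 * m))"
    using assms by (intro mult_left_mono) auto
  moreover have "(a * q + s) * (b * q + t) = a * b * q\<^sup>2 + q * (a * t + b * s) + s * t"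
    by (simp add: algebra_simps power2_eq_square)
  ultimately have up: "(a * q + s) * (b * q + t) \<le> a * b * q\<^sup>2 + 2 * m * q\<^sup>2 + m\<^sup>2"
    by (simp add: power2_eq_square algebra_simps)
  \<comment> \<open>The bound on \<open>m\<close> controls \<open>m\<^sup>2\<close>. The numbered
    facts multiply the hypotheses out, so that the claim becomes linear in the monomials.\<close>
  have "2 * m * q\<^sup>2 + m\<^sup>2 \<le> q * ?E"
  proof -
    have "2 * m * m \<le> (q * (q + 1) + 4) * m"
      using assms by (intro mult_right_mono) auto
    then have 1: "2 * m\<^sup>2 \<le> m * q\<^sup>2 + m * q + 4 * m"
      by (simp add: algebra_simps power2_eq_square)
    have "(2 * m - 2) * (2 * q\<^sup>2) \<le> (2 * m - 2) * (q * q\<^sup>2)"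
      using assms by (intro mult_left_mono mult_right_mono) auto
    then have 2: "4 * (m * q\<^sup>2) - 4 * q\<^sup>2 \<le> 2 * (m * (q * q\<^sup>2)) - 2 * (q * q\<^sup>2)"
      by (simp add: algebra_simps)
    have 3: "2 * q\<^sup>2 \<le> m * q\<^sup>2" "2 * q \<le> m * q"
      using assms by (auto intro!: mult_right_mono)
    have 4: "m * (2 * q) \<le> m * q\<^sup>2" "m * 2 \<le> m * q"
      using assms q2 by (auto intro!: mult_left_mono)
    have "q * ?E = 2 * (m * (q * q\<^sup>2)) - 2 * (q * q\<^sup>2) + 2 * (m * q\<^sup>2) - q\<^sup>2 + 2 * (m * q) - q"
      by (simp add: algebra_simps power2_eq_square)
    then show ?thesis
      using 1 2 3 4 \<open>m \<ge> 2\<close> by linarith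
  qed
  also have "\<dots> \<le> a * b * ?E"
    using ab assms by (intro mult_right_mono) auto
  finally have "(a * q + s) * (b * q + t) \<le> a * b * q\<^sup>2 + a * b * ?E"
    using up by simp
  also have "\<dots> = a * b * ((2 * m - 1) * (q * (q + 1) + 1))"
    by (simp add: algebra_simps power2_eq_square)
  also have "\<dots> \<le> c * ((2 * m - 1) * (q * (q + 1) + 1))"
    using assms by (intro mult_right_mono) auto
  finally show ?thesis .
qed

section \<open>Lower bounds for a short path and for \<open>m = 1\<close>\<close>

text \<open>Either one of the two sides lies inside the path, or both meet the clique; these cases
  are \<open>path_side_bound\<close> and \<open>clique_split_bound\<close>.\<close>

lemma lower_bound_short_path:
  fixes n m :: nat
  assumes n3: "n \<ge> 3" and m: "m \<ge> 2" "2 * m \<le> n * (n - 1) + 4"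
    and S: "S \<subset> verts (lollipop n m)" "S \<noteq> {}"
  shows "int (vol (lollipop n m) S) * int (vol (lollipop n m) (verts (lollipop n m) - S))
    \<le> int (cut (lollipop n m) S (verts (lollipop n m) - S))
      * ((2 * int m - 1) * (int n * (int n - 1) + 1))"
proof -
  let ?V = "verts (lollipop n m)"
  have m1: "m \<ge> 1"
    using m by simp
  note facts = volumes_cut_facts[OF n3 m1]
  have int_n: "int (n * (n - 1)) = int n * (int n - 1)" "int (n - 1) = int n - 1"
    using n3 by (simp_all add: of_nat_diff)
  have m_le: "2 * int m \<le> int n * (int n - 1) + 4"
    using m(2) int_n by linarith
  have even_N: "even (int n * (int n - 1))" and pos_N: "int n * (int n - 1) > 0"
    using n3 by auto
  \<comment> \<open>Stated for arbitrary \<open>T\<close>, since it is applied to \<open>S\<close>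
    and, if \<open>S\<close> contains the whole clique, to the complement.\<close>
  have path: "int (vol (lollipop n m) T) * int (vol (lollipop n m) (?V - T))
      \<le> int (cut (lollipop n m) T (?V - T)) * ((2 * int m - 1) * (int n * (int n - 1) + 1))"
    if T: "T \<subset> ?V" "T \<noteq> {}" "card {j. Y j \<in> T} = 0" for T
  proof (rule path_side_bound)
    have "{j. Y j \<in> T} = {}"
      using T finite_X_Y_preimages[of T] by auto
    then have "vol (lollipop n m) T \<le> 2 * m - 1"
      using vol_split[OF n3 m1, of T] path_degree_sum_le[OF n3 m1, of T] T by auto
    then show "int (vol (lollipop n m) T) \<le> 2 * int m - 1"
      using m1 by linarith
  qed (use facts[OF T(1,2)] m m_le even_N pos_N in auto)
  define a where "a = card {j. Y j \<in> S}"
  have sub: "S \<subseteq> ?V" "?V - S \<subseteq> ?V"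
    using S by auto
  note Yc = card_Y_complement[OF sub(1), folded a_def]
  consider "a = 0" | "a = n" | "1 \<le> a" "a < n"
    using Yc by linarith
  then show ?thesis
  proof cases
    case 1
    then show ?thesis
      using path[of S] S by (simp add: a_def)
  next
    case 2
    moreover have "?V - (?V - S) = S" "?V - S \<noteq> {}" "?V - S \<subset> ?V"
      using S by auto
    ultimately show ?thesis
      using path[of "?V - S"] Yc by (simp add: cut_commute[of _ _ S] mult.commute)
  next
    case 3
    \<comment> \<open>By \<open>vol_split\<close> nothing is truncated: \<open>s\<close> and
      \<open>t\<close> consist of path degrees and the extra unit at \<open>Y 1\<close>, which gives
      \<open>s + t = 2 * m\<close>.\<close>
    define s where "s = vol (lollipop n m) S - a * (n - 1)"
    define t where "t = vol (lollipop n m) (?V - S) - (n - a) * (n - 1)"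
    have s: "vol (lollipop n m) S = a * (n - 1) + s"
      using vol_split[OF n3 m1 sub(1)] by (simp add: s_def a_def)
    have t: "vol (lollipop n m) (?V - S) = (n - a) * (n - 1) + t"
      using vol_split[OF n3 m1 sub(2)] Yc by (simp add: t_def)
    have "a * (n - 1) + (n - a) * (n - 1) = n * (n - 1)"
      using 3 by (simp flip: add_mult_distrib)
    then have st: "s + t = 2 * m"
      using vol_add_complement[OF n3 m1 sub(1)] s t by linarith
    have "a * (n - a) \<le> cut (lollipop n m) S (?V - S)"
      using cut_ge_clique_cut[OF n3 m1 sub(1)] by (simp add: a_def)
    then have c: "int a * int (n - a) \<le> int (cut (lollipop n m) S (?V - S))"
      by (simp flip: of_nat_mult)
    have "int s + int t = 2 * int m"
      using st by linarith
    then have "(int a * (int n - 1) + int s) * (int (n - a) * (int n - 1) + int t)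
      \<le> int (cut (lollipop n m) S (?V - S)) * ((2 * int m - 1) * ((int n - 1) * (int n - 1 + 1) + 1))"
      using 3 n3 m m_le c
      by (intro clique_split_bound) (auto simp: of_nat_diff mult.commute)
    then show ?thesis
      using s t int_n by (simp add: mult.commute)
  qed
qed

text \<open>The volumes depend only on the number \<open>a\<close> of clique vertices in
  \<open>S\<close> and on the sides of \<open>X 1\<close> and \<open>Y 1\<close>. If these two
  agree, the side containing them has a clique vertex, and \<open>a * b\<close> crossing edges
  suffice; if not, the bridge adds one more.\<close>

lemma lower_bound_single_path_vertex:
  fixes n :: nat
  assumes n3: "n \<ge> 3" and S: "S \<subset> verts (lollipop n 1)" "S \<noteq> {}"
  shows "int (vol (lollipop n 1) S) * int (vol (lollipop n 1) (verts (lollipop n 1) - S))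
    \<le> int (cut (lollipop n 1) S (verts (lollipop n 1) - S)) * ((int n + 1) * (int n - 1))"
proof -
  let ?G = "lollipop n 1" let ?V = "verts ?G"
  have m1: "(1::nat) \<ge> 1"
    by simp
  have sub: "S \<subseteq> ?V"
    using S by auto
  define a b where "a = int (card {j. Y j \<in> S})" and "b = int n - a"
  have ab: "a \<ge> 0" "b \<ge> 0"
    using card_Y_complement(1)[OF sub] by (simp_all add: a_def b_def)
  have prod: "int (card {j. Y j \<in> S} * (n - card {j. Y j \<in> S})) = a * b"
    using card_Y_complement(1)[OF sub] by (simp add: a_def b_def of_nat_diff)
  have c: "int (cut ?G S (?V - S)) \<ge> a * b + (if X 1 \<in> S \<longleftrightarrow> Y 1 \<in> S then 0 else 1)"
    using cut_ge_clique_cut[OF n3 m1 sub, folded of_nat_le_iff[where ?'a = int]]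
    unfolding of_nat_add prod by (simp split: if_splits)
  have "{i. X i \<in> S} = (if X 1 \<in> S then {1} else {})"
  proof -
    have "i \<in> {i. X i \<in> S} \<longleftrightarrow> i \<in> (if X 1 \<in> S then {1} else {})" for i
      using subsetD[OF sub, of "X i"] by (cases "i = 1") auto
    then show ?thesis
      by (rule set_eqI)
  qed
  then have path: "(\<Sum>i | X i \<in> S. if i = 1 then 1 else 2 :: nat) = (if X 1 \<in> S then 1 else 0)"
    by (cases "X 1 \<in> S") simp_all
  have "int (vol ?G S) = int (card {j. Y j \<in> S} * (n - 1))
      + (if X 1 \<in> S then 1 else 0) + (if Y 1 \<in> S then 1 else 0)"
    unfolding vol_split[OF n3 m1 sub] path by simp
  then have v: "int (vol ?G S) = a * (int n - 1)
      + (if X 1 \<in> S then 1 else 0) + (if Y 1 \<in> S then 1 else 0)"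
    using n3 by (simp add: a_def of_nat_diff)
  have w: "int (vol ?G (?V - S)) = int n * (int n - 1) + 2 - int (vol ?G S)"
    using volumes_cut_facts(1)[OF n3 m1 S] by simp
  have n: "int n = a + b"
    by (simp add: b_def)
  have fin: "finite {j. Y j \<in> S}" "finite {j. Y j \<in> ?V - S}"
    using finite_X_Y_preimages sub by auto
  have main: "int (vol ?G S) * int (vol ?G (?V - S)) \<le>
      (a * b + (if X 1 \<in> S \<longleftrightarrow> Y 1 \<in> S then 0 else 1)) * ((int n + 1) * (int n - 1))"
  proof -
    define q where "q = int n - 1"
    have q: "q \<ge> 2" "a + b = q + 1"
      using n3 n by (auto simp: q_def)
    have v': "int (vol ?G S) = a * q + (if X 1 \<in> S then 1 else 0) + (if Y 1 \<in> S then 1 else 0)"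
      using v by (simp add: q_def)
    have w': "int (vol ?G (?V - S)) = (a + b) * q + 2 - int (vol ?G S)"
      using w n by (simp add: q_def)
    consider (both) "X 1 \<in> S" "Y 1 \<in> S" | (none) "X 1 \<notin> S" "Y 1 \<notin> S"
      | (diff) "(X 1 \<in> S) \<noteq> (Y 1 \<in> S)"
      by blast
    then have "int (vol ?G S) * int (vol ?G (?V - S)) \<le>
      (a * b + (if X 1 \<in> S \<longleftrightarrow> Y 1 \<in> S then 0 else 1)) * ((q + 2) * q)"
    proof cases
      case both
      then have "card {j. Y j \<in> S} > 0"
        using fin by (auto simp: card_gt_0_iff)
      then have "a \<ge> 1"
        by (simp add: a_def)
      then have "(b * q) * (a * q + 2) \<le> (b * q) * (a * (q + 2))"
        using ab q by (intro mult_left_mono) (auto simp: algebra_simps)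
      then show ?thesis
        using both unfolding v' w' by (simp add: algebra_simps)
    next
      case none
      have "card {j. Y j \<in> ?V - S} > 0"
        using fin none n3 by (auto simp: card_gt_0_iff intro!: exI[of _ 1])
      then have "b \<ge> 1"
        using card_Y_complement[OF sub] by (simp add: a_def b_def of_nat_diff)
      then have "(a * q) * (b * q + 2) \<le> (a * q) * (b * (q + 2))"
        using ab q by (intro mult_left_mono) (auto simp: algebra_simps)
      then show ?thesis
        using none unfolding v' w' by (simp add: algebra_simps)
    next
      case diff
      \<comment> \<open>The linear terms combine by \<open>a + b = q + 1\<close>. The split bridge
        contributes a whole \<open>(q + 2) * q\<close>, which covers
        \<open>(q + 1) * q + 1\<close>.\<close>
      have "(a * q + 1) * (b * q + 1) = a * b * q\<^sup>2 + (q + 1) * q + 1"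
        using q(2)[symmetric] by (simp add: algebra_simps power2_eq_square)
      also have "\<dots> \<le> a * b * ((q + 2) * q) + (q + 2) * q"
      proof -
        have "0 \<le> a * b * q"
          using ab q by simp
        then show ?thesis
          using q by (simp add: algebra_simps power2_eq_square)
      qed
      finally show ?thesis
        using diff unfolding v' w' by (auto simp: algebra_simps)
    qed
    then show ?thesis
      by (simp add: q_def algebra_simps)
  qed
  also have "\<dots> \<le> int (cut ?G S (?V - S)) * ((int n + 1) * (int n - 1))"
    using c n3 by (intro mult_right_mono) auto
  finally show ?thesis .
qed

text \<open>The optimal side for \<open>m = 1\<close>: product of volumes over cut is
  \<open>(n + 1) * (n - 1)\<close>, more than the \<open>n * (n - 1) + 1\<close> reached by
  \<open>{x_1}\<close>. The bridge is internal, so exactly the \<open>n - 1\<close> clique edges at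
  \<open>Y 1\<close> cross.\<close>

lemma volumes_cut_pendant_pair:
  assumes n3: "n \<ge> 3"
  defines "T \<equiv> {X 1, Y 1}"
  shows "T \<subset> verts (lollipop n 1)"
    and "vol (lollipop n 1) T = n + 1"
    and "vol (lollipop n 1) (verts (lollipop n 1) - T) = (n - 1) * (n - 1)"
    and "cut (lollipop n 1) T (verts (lollipop n 1) - T) = n - 1"
proof -
  let ?G = "lollipop n 1" let ?V = "verts ?G"
  have m1: "(1::nat) \<ge> 1"
    by simp
  have "Y 2 \<in> ?V - T"
    using n3 by (simp add: T_def)
  moreover have sub: "T \<subseteq> ?V"
    using n3 by (simp add: T_def)
  ultimately show "T \<subset> ?V"
    by blast
  show vol: "vol ?G T = n + 1"
    using degree_X[OF n3 m1, of 1] degree_Y[OF n3 m1, of 1] n3 by (simp add: vol_def T_def)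
  obtain k where k: "n = Suc k"
    using n3 by (cases n) auto
  show "vol ?G (?V - T) = (n - 1) * (n - 1)"
    using vol_add_complement[OF n3 m1 sub] vol by (simp add: k)
  have card: "card {j. Y j \<in> T} = 1"
    by (simp add: T_def)
  have "{e \<in> edges ?G. \<exists>u\<in>T. \<exists>v\<in>?V - T. e = {u, v}} \<subseteq> (\<lambda>j. {Y 1, Y j}) ` {2..n}"
  proof clarify
    fix u v
    assume *: "{u, v} \<in> edges ?G" "u \<in> T" "v \<in> ?V" "v \<notin> T"
    then show "{u, v} \<in> (\<lambda>j. {Y 1, Y j}) ` {2..n}"
      by (cases v) (auto simp: T_def)
  qed
  then have "cut ?G T (?V - T) \<le> card ((\<lambda>j. {Y 1, Y j}) ` {2..n})"
    unfolding cut_def by (intro card_mono) auto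
  also have "\<dots> \<le> n - 1"
    using card_image_le[of "{2..n}"] by auto
  finally show "cut ?G T (?V - T) = n - 1"
    using cut_ge_clique_cut[OF n3 m1 sub] card by (simp add: T_def)
qed

section \<open>The four cases of the formula\<close>

theorem theorem4:
  fixes n m :: nat and o1 :: bool
  assumes "n \<ge> 3" and "m \<ge> 1"
    and o1: "o1 \<longleftrightarrow> ((real n)^2 - real n + 2 * real m + 2) / 4 \<in> \<int>"
  shows "(2 \<le> m \<and> real m \<le> ((real n)^2 - real n + 4) / 2 \<longrightarrow>
           Mcut (lollipop n m) =
             ((real n)^2 - real n + 2 * real m) / ((2 * real m - 1) * ((real n)^2 - real n + 1)))
       \<and> (o1 \<and> real m > ((real n)^2 - real n + 4) / 2 \<longrightarrow>
           Mcut (lollipop n m) = 4 / ((real n)^2 - real n + 2 * real m))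
       \<and> (\<not> o1 \<and> real m > ((real n)^2 - real n + 4) / 2 \<longrightarrow>
           Mcut (lollipop n m) =
             4 * ((real n)^2 - real n + 2 * real m) /
             ((real n * (real n - 1) + 2 * (real m - 1)) * (real n * (real n - 1) + 2 * (real m + 1))))
       \<and> (m = 1 \<longrightarrow>
           Mcut (lollipop n m) = ((real n)^2 - real n + 2) / ((real n + 1) * (real n - 1)))"
proof -
  note nm = assms(1,2)
  let ?G = "lollipop n m" let ?V = "verts ?G"
  define N where "N = n * (n - 1)"
  have N: "(real n)\<^sup>2 - real n = real N" "real n * (real n - 1) = real N"
    "int n * (int n - 1) = int N"
    using nm by (simp_all add: N_def of_nat_diff power2_eq_square algebra_simps)
  have even_N: "even N"
    unfolding N_def by (rule even_mult_pred)
  \<comment> \<open>As \<open>N + 2 * m\<close> is even, \<open>o1\<close> says that half of the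
    total volume is odd, that is, of the form \<open>2 * k - 1\<close>.\<close>
  have o1': "o1 \<longleftrightarrow> 4 dvd N + 2 * m + 2"
  proof -
    have "o1 \<longleftrightarrow> real (N + 2 * m + 2) / real 4 \<in> \<int>"
      unfolding o1 N by (simp add: add_ac)
    also have "\<dots> \<longleftrightarrow> 4 dvd N + 2 * m + 2"
    proof
      assume "real (N + 2 * m + 2) / real 4 \<in> \<int>"
      then obtain z where "real (N + 2 * m + 2) / real 4 = of_int z"
        by (auto elim: Ints_cases)
      then have "real_of_int (int (N + 2 * m + 2)) = real_of_int (4 * z)"
        by simp
      then have "int (N + 2 * m + 2) = 4 * z"
        by (simp only: of_int_eq_iff)
      then show "4 dvd N + 2 * m + 2"
        by presburger
    next
      assume "4 dvd N + 2 * m + 2"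
      then obtain k where "N + 2 * m + 2 = 4 * k"
        by blast
      then have "real (N + 2 * m + 2) / real 4 = of_nat k"
        by (simp only: of_nat_mult)
      then show "real (N + 2 * m + 2) / real 4 \<in> \<int>"
        by (metis Ints_of_nat)
    qed
    finally show ?thesis .
  qed
  note facts = volumes_cut_facts[OF nm, unfolded N]

  have short: "Mcut ?G = (real N + 2 * real m) / ((2 * real m - 1) * (real N + 1))"
    if m: "2 \<le> m" "real m \<le> (real N + 4) / 2"
  proof -
    have "Mcut ?G = (real (n * (n - 1)) + 2 * real m) / ((2 * real m - 1) * (real N + 1))"
    proof (rule Mcut_eq_prefixI[OF nm, where k = m])
      show "(2 * real m - 1) * (real N + 1)
          = real (2 * m - 1) * real (n * (n - 1) + 2 * m - (2 * m - 1))"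
        unfolding N_def[symmetric] using nm by (simp add: of_nat_diff)
      fix S assume S: "S \<subset> ?V" "S \<noteq> {}"
      have "2 * m \<le> n * (n - 1) + 4"
        using m(2) of_nat_le_iff[of "2 * m" "N + 4", where ?'a = real] by (simp add: N_def)
      from of_int_mult_le_of_real[OF lower_bound_short_path[OF nm(1) m(1) this S]]
      show "real (vol ?G S) * real (vol ?G (?V - S))
          \<le> real (cut ?G S (?V - S)) * ((2 * real m - 1) * (real N + 1))"
        unfolding N by simp
    qed (use nm in auto)
    then show ?thesis
      unfolding N_def .
  qed

  \<comment> \<open>With a fixed sum, the product of the volumes is governed by their difference.
    Both long cases bound that difference from below.\<close>
  have amgm: "4 * (real (vol ?G S) * real (vol ?G (?V - S)))
      = (real N + 2 * real m)\<^sup>2 - (real (vol ?G S) - real (vol ?G (?V - S)))\<^sup>2"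
    if S: "S \<subset> ?V" "S \<noteq> {}" for S
  proof -
    have "real N + 2 * real m = real (vol ?G S) + real (vol ?G (?V - S))"
      using arg_cong[OF vol_add_complement[OF nm psubset_imp_subset[OF S(1)]], of real]
      unfolding N_def by simp
    then show ?thesis
      by (simp add: power2_eq_square algebra_simps)
  qed

  have long1: "Mcut ?G = 4 / (real N + 2 * real m)"
    if m: "o1" "real m > (real N + 4) / 2"
  proof -
    \<comment> \<open>This \<open>k\<close> makes \<open>2 * k - 1\<close> exactly half of the total
      volume. The path is long enough for it: \<open>N + 4 < 2 * m\<close> yields
      \<open>4 * k < 4 * m\<close>.\<close>
    obtain k where k: "N + 2 * m + 2 = 4 * k"
      using m(1) o1' by blast
    have "N + 4 < 2 * m"
      using m(2) of_nat_less_iff[of "N + 4" "2 * m", where ?'a = real] by simp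
    then have km: "1 \<le> k" "k \<le> m"
      using k by linarith+
    have real_k: "real N + 2 * real m = 4 * real k - 2"
      using arg_cong[OF k, of real] by simp
    have "Mcut ?G = (real (n * (n - 1)) + 2 * real m) / ((real N + 2 * real m)\<^sup>2 / 4)"
    proof (rule Mcut_eq_prefixI[OF nm km])
      have eqs: "real (2 * k - 1) = (real N + 2 * real m) / 2"
          "real (N + 2 * m - (2 * k - 1)) = (real N + 2 * real m) / 2"
        using real_k km by (simp_all add: of_nat_diff)
      show "(real N + 2 * real m)\<^sup>2 / 4
          = real (2 * k - 1) * real (n * (n - 1) + 2 * m - (2 * k - 1))"
        unfolding N_def[symmetric] eqs by (simp add: power2_eq_square)
      fix S assume S: "S \<subset> ?V" "S \<noteq> {}"
      have "real (vol ?G S) * real (vol ?G (?V - S)) \<le> 1 * ((real N + 2 * real m)\<^sup>2 / 4)"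
        using amgm[OF S] zero_le_power2[of "real (vol ?G S) - real (vol ?G (?V - S))"] by linarith
      also have "\<dots> \<le> real (cut ?G S (?V - S)) * ((real N + 2 * real m)\<^sup>2 / 4)"
        using facts(2)[OF S] by (intro mult_right_mono) auto
      finally show "real (vol ?G S) * real (vol ?G (?V - S))
          \<le> real (cut ?G S (?V - S)) * ((real N + 2 * real m)\<^sup>2 / 4)" .
    qed
    moreover have "W / (W\<^sup>2 / 4) = 4 / W" for W :: real
      by (simp add: power2_eq_square)
    ultimately show ?thesis
      unfolding N_def[symmetric] by (rule trans)
  qed

  have long2: "Mcut ?G = 4 * (real N + 2 * real m) /
      ((real N + 2 * (real m - 1)) * (real N + 2 * (real m + 1)))"
    if m: "\<not> o1" "real m > (real N + 4) / 2"
  proof -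
    \<comment> \<open>The product of the volumes one below and one above half of the total, the
      former being \<open>2 * k - 1\<close> for the \<open>k\<close> chosen next.\<close>
    let ?D = "((real N + 2 * real m)\<^sup>2 - 4) / 4"
    have "4 dvd N + 2 * m"
      using m(1) o1' even_N by presburger
    then obtain k where k: "N + 2 * m = 4 * k"
      by blast
    have "N + 4 < 2 * m"
      using m(2) of_nat_less_iff[of "N + 4" "2 * m", where ?'a = real] by simp
    then have km: "1 \<le> k" "k \<le> m"
      using k by linarith+
    have real_k: "real N + 2 * real m = 4 * real k"
      using arg_cong[OF k, of real] by simp
    have W: "real N + 2 * real m \<ge> 4"
      using km real_k by simp
    have "Mcut ?G = (real (n * (n - 1)) + 2 * real m) / ?D"
    proof (rule Mcut_eq_prefixI[OF nm km])
      have eqs: "real (2 * k - 1) = (real N + 2 * real m) / 2 - 1"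
          "real (N + 2 * m - (2 * k - 1)) = (real N + 2 * real m) / 2 + 1"
        using real_k km by (simp_all add: of_nat_diff)
      show "?D = real (2 * k - 1) * real (n * (n - 1) + 2 * m - (2 * k - 1))"
        unfolding N_def[symmetric] eqs by (simp add: power2_eq_square field_simps)
      fix S assume S: "S \<subset> ?V" "S \<noteq> {}"
      let ?v = "real (vol ?G S)" and ?w = "real (vol ?G (?V - S))"
      show "?v * ?w \<le> real (cut ?G S (?V - S)) * ?D"
      proof (cases "cut ?G S (?V - S) = 1")
        case True
        \<comment> \<open>A single crossing edge forces odd volume, whereas the balanced value
          \<open>2 * k\<close> is even; so the volumes differ by at least 2.\<close>
        then have "odd (vol ?G S)"
          using facts(3)[OF S] by simp
        then have "vol ?G S \<noteq> 2 * k"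
          by auto
        moreover have "vol ?G S + vol ?G (?V - S) = 4 * k"
          using facts(1)[OF S] k by linarith
        ultimately have "\<bar>?v - ?w\<bar> \<ge> \<bar>2\<bar>"
          by (simp add: abs_if)
        then have "(?v - ?w)\<^sup>2 \<ge> 2\<^sup>2"
          by (rule abs_le_square_iff[THEN iffD1])
        then show ?thesis
          using amgm[OF S] True by simp
      next
        case False
        then have "cut ?G S (?V - S) \<ge> 2"
          using facts(2)[OF S] by linarith
        \<comment> \<open>With two crossing edges even balanced volumes are harmless: a quarter of
          this square is then at most \<open>2 * ?D\<close>.\<close>
        moreover have W2: "(real N + 2 * real m)\<^sup>2 \<ge> 16"
          using power_mono[OF W, of 2] by simp
        ultimately have "2 * ?D \<le> real (cut ?G S (?V - S)) * ?D"
          by (intro mult_right_mono) auto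
        moreover have "p \<le> 2 * ((a - 4) / 4)" if "4 * p = a - b" "b \<ge> 0" "a \<ge> 16" for p a b :: real
          using that by simp
        from this[OF amgm[OF S] zero_le_power2 W2] have "?v * ?w \<le> 2 * ?D" .
        ultimately show ?thesis
          by linarith
      qed
    qed
    also have "?D = (real N + 2 * (real m - 1)) * (real N + 2 * (real m + 1)) / 4"
      by (simp add: power2_eq_square algebra_simps)
    finally show ?thesis
      unfolding N_def[symmetric] by (simp only: divide_divide_eq_right mult.commute)
  qed

  have single: "Mcut ?G = (real N + 2) / ((real n + 1) * (real n - 1))" if "m = 1"
  proof -
    note pair = volumes_cut_pendant_pair[OF nm(1)]
    have "Mcut (lollipop n 1) = (real (n * (n - 1)) + 2 * real 1) / ((real n + 1) * (real n - 1))"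
    proof (rule Mcut_eqI[OF nm(1) order_refl _ _ pair(1)])
      show "(real n + 1) * (real n - 1) > 0"
        using nm by simp
      fix S assume S: "S \<subset> verts (lollipop n 1)" "S \<noteq> {}"
      from of_int_mult_le_of_real[OF lower_bound_single_path_vertex[OF nm(1) S]]
      show "real (vol (lollipop n 1) S) * real (vol (lollipop n 1) (verts (lollipop n 1) - S))
        \<le> real (cut (lollipop n 1) S (verts (lollipop n 1) - S)) * ((real n + 1) * (real n - 1))"
        by simp
    next
      show "real (vol (lollipop n 1) {X 1, Y 1})
          * real (vol (lollipop n 1) (verts (lollipop n 1) - {X 1, Y 1}))
        = real (cut (lollipop n 1) {X 1, Y 1} (verts (lollipop n 1) - {X 1, Y 1}))
          * ((real n + 1) * (real n - 1))"
        unfolding pair(2-4) using nm by (simp add: of_nat_diff)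
    qed simp
    then show ?thesis
      using that by (simp add: N_def)
  qed

  show ?thesis
    unfolding N using short long1 long2 single by blast
qed

end
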